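(* Let $\omega_1$ be the first uncountable ordinal and equip the ordinal interval $[0,\omega_1]$ with its order topology. Then $[0,\omega_1]$ does not admit a closeness function. Hence, it does not admit a $B_{\mathcal{M}([0,\omega_1])}$-compensation function either.
   Context: For a compact Hausdorff space $K$, $\mathcal{M}(K)=C(K)^*$ is the space of regular Borel signed (real) measures on $K$ with the total variation norm, $B_{\mathcal{M}(K)}$ is its closed unit ball, $\omega^*$ its weak$^*$ topology, and $\mu^+$ is the positive part of $\mu\in\mathcal{M}(K)$. A closeness function for $K$ is a continuous function $c\colon\{(x,y,z)\in K^3\colon y\ne z\}\to[-1,1]$ such that (i) $c(x,y,z)=-c(x,z,y)$ whenever $y\neq z$; (ii) $c(x,x,z)=1$ whenever $x\ne z$. $\nu\in\mathcal{M}(K)$ is a compensation of $\mu\in\mathcal{M}(K)$ if: $0\le\nu\le\mu^+$ and $\nu(K)=\mu(K)$ in case $\mu(K)>0$; and $\nu=0$ in case $\mu(K)\le 0$. A $B_{\mathcal{M}(K)}$-compensation function is an $\omega^*$-$\omega^*$-continuous map $\xi\colon B_{\mathcal{M}(K)}\to\mathcal{M}(K)$ such that $\xi(\mu)$ is a compensation of $\mu$ for every $\mu\in B_{\mathcal{M}(K)}$. *)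

theory Defs
  imports "HOL-Analysis.Analysis"
begin

text \<open>
  The compact Hausdorff space \<open>K\<close> of the text is the universe of a type of class \<open>t2_space\<close>
  for which \<open>compact UNIV\<close> holds.
\<close>

section \<open>Closeness functions\<close>

definition closeness_function :: "('a::t2_space \<times> 'a \<times> 'a \<Rightarrow> real) \<Rightarrow> bool" where
  "closeness_function c \<longleftrightarrow>
     continuous_on {(x, y, z). y \<noteq> z} c \<and>
     (\<forall>x y z. y \<noteq> z \<longrightarrow> c (x, y, z) \<in> {-1..1}) \<and>
     (\<forall>x y z. y \<noteq> z \<longrightarrow> c (x, y, z) = - c (x, z, y)) \<and>
     (\<forall>x z. x \<noteq> z \<longrightarrow> c (x, x, z) = 1)"

section \<open>Regular signed Borel measures\<close>

text \<open>
  A signed measure is a countably additive set function on the Borel sets with values in \<open>real\<close>.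
  It is made a total function on sets by the convention that it vanishes outside the
  Borel sets, so that equality of functions is equality of measures.
\<close>

definition signed_borel_measure :: "('a::topological_space set \<Rightarrow> real) \<Rightarrow> bool" where
  "signed_borel_measure \<mu> \<longleftrightarrow>
     (\<forall>A. A \<notin> sets borel \<longrightarrow> \<mu> A = 0) \<and>
     (\<forall>A :: nat \<Rightarrow> 'a set. range A \<subseteq> sets borel \<and> disjoint_family A \<longrightarrow>
        (\<lambda>n. \<mu> (A n)) sums \<mu> (\<Union>n. A n))"

text \<open>
  Jordan decomposition. The suprema are suprema of bounded sets of reals, since a
  real-valued signed measure is bounded.
\<close>

definition pos_part :: "('a::topological_space set \<Rightarrow> real) \<Rightarrow> 'a set \<Rightarrow> real" where
  "pos_part \<mu> A =
     (if A \<in> sets borel then SUP B\<in>{B \<in> sets borel. B \<subseteq> A}. \<mu> B else 0)"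

definition neg_part :: "('a::topological_space set \<Rightarrow> real) \<Rightarrow> 'a set \<Rightarrow> real" where
  "neg_part \<mu> = pos_part (\<lambda>A. - \<mu> A)"

definition variation :: "('a::topological_space set \<Rightarrow> real) \<Rightarrow> 'a set \<Rightarrow> real" where
  "variation \<mu> A = pos_part \<mu> A + neg_part \<mu> A"

definition regular_signed_measures :: "('a::t2_space set \<Rightarrow> real) set" where
  "regular_signed_measures =
     {\<mu>. signed_borel_measure \<mu> \<and>
        (\<forall>A \<in> sets borel. \<forall>\<epsilon>>0. \<exists>C U. compact C \<and> open U \<and> C \<subseteq> A \<and> A \<subseteq> U \<and>
           variation \<mu> (U - C) < \<epsilon>)}"

definition signed_measure_ball :: "('a::t2_space set \<Rightarrow> real) set" where
  "signed_measure_ball = {\<mu> \<in> regular_signed_measures. variation \<mu> UNIV \<le> 1}"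

section \<open>The weak* topology\<close>

definition as_measure :: "('a::topological_space set \<Rightarrow> real) \<Rightarrow> 'a measure" where
  "as_measure \<mu> = measure_of UNIV (sets borel) (\<lambda>A. ennreal (\<mu> A))"

definition signed_integral :: "('a::topological_space set \<Rightarrow> real) \<Rightarrow> ('a \<Rightarrow> real) \<Rightarrow> real" where
  "signed_integral \<mu> f =
     (LINT x|as_measure (pos_part \<mu>). f x) - (LINT x|as_measure (neg_part \<mu>). f x)"

text \<open>
  The coarsest topology on the regular signed measures that makes integration against every
  continuous function continuous.
\<close>

definition weak_star :: "('a::t2_space set \<Rightarrow> real) topology" where
  "weak_star = topology_generated_by
     {{\<mu> \<in> regular_signed_measures. signed_integral \<mu> f \<in> V} | f V.
        continuous_on UNIV f \<and> open V}"

lemma topspace_weak_star: "topspace weak_star = regular_signed_measures"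
proof -
  have "continuous_on UNIV (\<lambda>x::'a. 0::real) \<and> open (UNIV :: real set)"
    by simp
  then show ?thesis
    unfolding weak_star_def topology_generated_by_topspace by blast
qed

section \<open>Compensation functions\<close>

definition compensation ::
    "('a::t2_space set \<Rightarrow> real) \<Rightarrow> ('a set \<Rightarrow> real) \<Rightarrow> bool" where
  "compensation \<nu> \<mu> \<longleftrightarrow>
     \<nu> \<in> regular_signed_measures \<and> \<mu> \<in> regular_signed_measures \<and>
     (if \<mu> UNIV > 0
      then (\<forall>A \<in> sets borel. 0 \<le> \<nu> A \<and> \<nu> A \<le> pos_part \<mu> A) \<and> \<nu> UNIV = \<mu> UNIV
      else \<nu> = (\<lambda>A. 0))"

definition ball_compensation_function ::
    "(('a::t2_space set \<Rightarrow> real) \<Rightarrow> 'a set \<Rightarrow> real) \<Rightarrow> bool" where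
  "ball_compensation_function \<xi> \<longleftrightarrow>
     continuous_map (subtopology weak_star signed_measure_ball) weak_star \<xi> \<and>
     (\<forall>\<mu> \<in> signed_measure_ball. compensation (\<xi> \<mu>) \<mu>)"

section \<open>The ordinal interval \<open>[0, \<omega>\<^sub>1]\<close>\<close>

text \<open>
  The well-order \<open>cardSuc natLeq\<close> is the successor cardinal of \<open>\<omega>\<close>, i.e. \<open>\<omega>\<^sub>1\<close>. Its field
  consists of the ordinals below \<open>\<omega>\<^sub>1\<close>; the additional point \<open>None\<close> is placed on top and
  stands for \<open>\<omega>\<^sub>1\<close> itself.
\<close>

typedef omega1_interval = "insert None (Some ` Field (cardSuc natLeq))"
  by blast

lemma Card_order_omega1: "Card_order (cardSuc natLeq)"
  by (simp add: cardSuc_Card_order natLeq_Card_order)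

lemma wo_rel_omega1: "wo_rel (cardSuc natLeq)"
  using Card_order_omega1 by (simp add: card_order_on_well_order_on wo_rel_def)

instantiation omega1_interval :: linorder
begin

definition less_eq_omega1_interval :: "omega1_interval \<Rightarrow> omega1_interval \<Rightarrow> bool" where
  "x \<le> y \<longleftrightarrow>
     (case Rep_omega1_interval y of
        None \<Rightarrow> True
      | Some b \<Rightarrow> (case Rep_omega1_interval x of
          None \<Rightarrow> False
        | Some a \<Rightarrow> (a, b) \<in> cardSuc natLeq))"

definition less_omega1_interval :: "omega1_interval \<Rightarrow> omega1_interval \<Rightarrow> bool" where
  "x < y \<longleftrightarrow> x \<le> y \<and> \<not> y \<le> x" for x y :: omega1_interval

instance
proof
  fix x y z :: omega1_interval
  let ?r = "cardSuc natLeq"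
  have inF: "Rep_omega1_interval u = Some a \<Longrightarrow> a \<in> Field ?r" for u a
    using Rep_omega1_interval[of u] by auto
  show "x < y \<longleftrightarrow> x \<le> y \<and> \<not> y \<le> x"
    by (rule less_omega1_interval_def)
  show "x \<le> x"
    using wo_rel.REFL[OF wo_rel_omega1] inF
    by (auto simp: less_eq_omega1_interval_def refl_on_def split: option.splits)
  show "x \<le> y \<Longrightarrow> y \<le> z \<Longrightarrow> x \<le> z"
    using wo_rel.TRANS[OF wo_rel_omega1]
    by (auto simp: less_eq_omega1_interval_def split: option.splits dest: transD)
  show "x \<le> y \<Longrightarrow> y \<le> x \<Longrightarrow> x = y"
    using wo_rel.ANTISYM[OF wo_rel_omega1]
    by (auto simp: less_eq_omega1_interval_def simp flip: Rep_omega1_interval_inject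
             split: option.splits dest: antisymD)
  show "x \<le> y \<or> y \<le> x"
    using wo_rel.TOTALS[OF wo_rel_omega1] inF
    by (auto simp: less_eq_omega1_interval_def split: option.splits)
qed

end

instantiation omega1_interval :: linorder_topology
begin

definition open_omega1_interval :: "omega1_interval set \<Rightarrow> bool" where
  "open_omega1_interval =
     generate_topology (range (\<lambda>a. {..< a}) \<union> range (\<lambda>a. {a <..}))"

instance
  by standard (rule open_omega1_interval_def)

end

instantiation omega1_interval :: order_top
begin

definition top_omega1_interval :: omega1_interval where
  "top_omega1_interval = Abs_omega1_interval None"

instance
  by standard (simp add: top_omega1_interval_def less_eq_omega1_interval_def Abs_omega1_interval_inverse)

end

lemma Rep_top_omega1_interval: "Rep_omega1_interval top = None"
  by (simp add: top_omega1_interval_def Abs_omega1_interval_inverse)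

lemma Rep_omega1_interval_below_top:
  assumes "x < top"
  obtains a where "Rep_omega1_interval x = Some a" "a \<in> Field (cardSuc natLeq)"
proof -
  have "Rep_omega1_interval x \<noteq> None"
    using assms Rep_top_omega1_interval Rep_omega1_interval_inject[of x top] by auto
  then show thesis
    using that Rep_omega1_interval[of x] by auto
qed

instance omega1_interval :: wellorder
proof
  fix P :: "omega1_interval \<Rightarrow> bool" and a
  assume step: "\<And>x. (\<And>y. y < x \<Longrightarrow> P y) \<Longrightarrow> P x"
  let ?r = "cardSuc natLeq"
  have wf: "wf (?r - Id)"
    using wo_rel.WF[OF wo_rel_omega1] .
  have below: "P x" if "Rep_omega1_interval x = Some b" for b x
    using that
  proof (induction b arbitrary: x rule: wf_induct_rule[OF wf])
    case (1 b)
    show ?case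
    proof (rule step)
      fix y assume "y < x"
      then have le: "y \<le> x" and ne: "y \<noteq> x"
        by auto
      from le obtain c where c: "Rep_omega1_interval y = Some c" "(c, b) \<in> ?r"
        using 1(2) by (auto simp: less_eq_omega1_interval_def split: option.splits)
      moreover have "c \<noteq> b"
        using ne c(1) 1(2) Rep_omega1_interval_inject[of y x] by auto
      ultimately show "P y"
        using 1(1)[of c y] by auto
    qed
  qed
  show "P a"
  proof (rule step)
    fix y assume "y < a"
    then have "y < top"
      using top_greatest less_le_trans by blast
    then show "P y"
      using Rep_omega1_interval_below_top below by metis
  qed
qed

unbundle cardinal_syntax

lemma countable_iff_card_le_natLeq: "countable A \<longleftrightarrow> |A| \<le>o natLeq"
proof -
  have "countable A \<longleftrightarrow> |A| \<le>o |UNIV :: nat set|"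
    by (simp add: countable_def flip: card_of_ordLeq)
  also have "\<dots> \<longleftrightarrow> |A| \<le>o natLeq"
    using card_of_nat ordLeq_ordIso_trans ordIso_symmetric by blast
  finally show ?thesis .
qed

text \<open>
  Together with the existence of a top element in a well-order, the following two facts
  characterise the order type \<open>\<omega>\<^sub>1 + 1\<close>.
\<close>

lemma countable_below_omega1:
  fixes x :: omega1_interval
  assumes "x < top"
  shows "countable {..<x}"
proof -
  let ?r = "cardSuc natLeq"
  obtain a where a: "Rep_omega1_interval x = Some a" "a \<in> Field ?r"
    using Rep_omega1_interval_below_top[OF assms] .
  have "|underS ?r a| <o ?r"
    using card_of_underS[OF Card_order_omega1 a(2)] .
  then have "|underS ?r a| \<le>o natLeq"
    using cardSuc_ordLeq_ordLess[OF natLeq_Card_order card_of_Card_order] by blast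
  then have cnt: "countable (underS ?r a)"
    by (simp only: countable_iff_card_le_natLeq)
  have "Rep_omega1_interval ` {..<x} \<subseteq> Some ` underS ?r a"
  proof
    fix v assume "v \<in> Rep_omega1_interval ` {..<x}"
    then obtain y where y: "v = Rep_omega1_interval y" "y \<le> x" "y \<noteq> x"
      by auto
    then obtain b where "v = Some b" "(b, a) \<in> ?r"
      using a(1) by (auto simp: less_eq_omega1_interval_def split: option.splits)
    moreover have "b \<noteq> a"
      using y a(1) calculation Rep_omega1_interval_inject[of y x] by auto
    ultimately show "v \<in> Some ` underS ?r a"
      by (auto simp: underS_def)
  qed
  then have "countable (Rep_omega1_interval ` {..<x})"
    by (rule countable_subset) (intro countable_image cnt)
  then show ?thesis
    by (rule countable_image_inj_on) (simp add: inj_on_def Rep_omega1_interval_inject)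
qed

lemma uncountable_omega1: "uncountable {..<(top :: omega1_interval)}"
proof
  let ?r = "cardSuc natLeq"
  assume cnt: "countable {..<(top :: omega1_interval)}"
  have "Field ?r \<subseteq> (the \<circ> Rep_omega1_interval) ` {..<top}"
  proof
    fix a assume "a \<in> Field ?r"
    then have R: "Rep_omega1_interval (Abs_omega1_interval (Some a)) = Some a"
      by (simp add: Abs_omega1_interval_inverse)
    then have "Abs_omega1_interval (Some a) \<noteq> top"
      using Rep_top_omega1_interval by (metis option.distinct(1))
    then have "Abs_omega1_interval (Some a) < top"
      using top_greatest le_neq_trans by blast
    then show "a \<in> (the \<circ> Rep_omega1_interval) ` {..<top}"
      using R by (intro image_eqI[of _ _ "Abs_omega1_interval (Some a)"]) auto
  qed
  then have "countable (Field ?r)"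
    by (rule countable_subset) (intro countable_image cnt)
  then have "|Field ?r| \<le>o natLeq"
    by (simp only: countable_iff_card_le_natLeq)
  then have "?r \<le>o natLeq"
    by (rule ordIso_ordLeq_trans[OF ordIso_symmetric[OF card_of_Field_ordIso[OF Card_order_omega1]]])
  then show False
    using cardSuc_greater[OF natLeq_Card_order] not_ordLess_ordLeq by blast
qed

unbundle no cardinal_syntax

lemma compact_omega1_interval: "compact (UNIV :: omega1_interval set)"
proof (rule compactI)
  fix C :: "omega1_interval set set"
  assume op: "\<forall>U\<in>C. open U" and cov: "UNIV \<subseteq> \<Union>C"
  have "\<exists>D\<subseteq>C. finite D \<and> {..x} \<subseteq> \<Union>D" for x
  proof (induction x rule: less_induct)
    case (less x)
    obtain U where U: "U \<in> C" "x \<in> U" "open U"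
      using cov op by blast
    show ?case
    proof (cases "\<exists>y. y < x")
      case True
      then obtain b where b: "b < x" "{b<..x} \<subseteq> U"
        using open_left[OF U(3,2)] by blast
      obtain D where "D \<subseteq> C" "finite D" "{..b} \<subseteq> \<Union>D"
        using less[OF b(1)] by blast
      moreover have "{..x} \<subseteq> {..b} \<union> {b<..x}"
        by auto
      ultimately show ?thesis
        using U(1) b(2) by (intro exI[of _ "insert U D"]) blast
    next
      case False
      then have "{..x} = {x}"
        by (auto simp: order_le_less)
      then show ?thesis
        using U by (intro exI[of _ "{U}"]) auto
    qed
  qed
  from this[of top] show "\<exists>D\<subseteq>C. finite D \<and> UNIV \<subseteq> \<Union>D"
    by (simp add: atMost_def)
qed

end

theory Submission
  imports Defs
begin

text \<open>
  On \<open>[0, \<omega>\<^sub>1]\<close> a continuous real function is constant near \<open>\<omega>\<^sub>1\<close>, so for every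
  \<open>y < \<omega>\<^sub>1\<close> a closeness function satisfies \<open>c(x, y, \<omega>\<^sub>1) = c(\<omega>\<^sub>1, y, \<omega>\<^sub>1) = -1\<close> for all
  \<open>x \<ge> f(y)\<close>, where \<open>y < f(y) < \<omega>\<^sub>1\<close>. Let \<open>\<alpha> < \<omega>\<^sub>1\<close> be the supremum of the iterates
  \<open>y\<^sub>n = f\<^sup>n(0)\<close>. Then \<open>c(\<alpha>, y\<^sub>n, \<omega>\<^sub>1) = -1\<close> for all \<open>n\<close>, whereas \<open>c(\<alpha>, y\<^sub>n, \<omega>\<^sub>1)\<close> tends to
  \<open>c(\<alpha>, \<alpha>, \<omega>\<^sub>1) = 1\<close>.

  A compensation function \<open>\<xi>\<close> on any compact Hausdorff space yields a closeness function: the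
  compensation \<open>\<nu>\<close> of \<open>(\<delta>\<^sub>y + \<delta>\<^sub>z - \<delta>\<^sub>x) / 3\<close> is carried by \<open>{y, z}\<close> and has total mass \<open>1/3\<close>,
  and \<open>c(x, y, z) = 3 (\<nu>{z} - \<nu>{y})\<close> works. Near a given triple \<open>c\<close> is the integral with
  respect to \<open>\<nu>\<close> of a fixed continuous function, whence its continuity.
\<close>

section \<open>Countable cofinality arguments in \<open>[0, \<omega>\<^sub>1]\<close>\<close>

text \<open>Uncountable cofinality: the initial segments \<open>{..a}\<close> with \<open>a\<close>
  in \<open>A\<close> are countable, so countably many of them cannot cover the uncountable
  \<open>{..<top}\<close>; any point they miss lies above all of \<open>A\<close>.\<close>

lemma countable_strict_bound_omega1:
  fixes A :: "omega1_interval set"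
  assumes "countable A" and "A \<subseteq> {..<top}"
  shows "\<exists>b<top. \<forall>a\<in>A. a < b"
proof -
  have "countable {..a}" if "a \<in> A" for a
  proof -
    have "{..a} = insert a {..<a}"
      by auto
    then show ?thesis
      using countable_below_omega1[of a] assms(2) that by auto
  qed
  then have "countable (\<Union>a\<in>A. {..a})"
    using assms(1) by auto
  then have "\<not> {..<top} \<subseteq> (\<Union>a\<in>A. {..a})"
    using uncountable_omega1 countable_subset by blast
  then obtain b where "b < top" "b \<notin> (\<Union>a\<in>A. {..a})"
    by auto
  then show ?thesis
    by (auto simp: not_le)
qed

text \<open>Supplies the point below \<open>top\<close> that \<open>open_left\<close> requires, and
  later the start of an iteration.\<close>

lemma bot_less_top_omega1: "\<exists>y. y < (top :: omega1_interval)"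
  using countable_strict_bound_omega1[of "{}"] by auto

text \<open>Each precision 1/(n+1) is reached beyond some \<open>s n < top\<close>; a common bound
  of these countably many thresholds serves all precisions at once.\<close>

lemma eventually_const_at_omega1:
  fixes g :: "omega1_interval \<Rightarrow> real"
  assumes "continuous_on UNIV g"
  obtains b where "b < top" and "\<And>x. b \<le> x \<Longrightarrow> g x = g top"
proof -
  have "\<exists>b<top. \<forall>x>b. \<bar>g x - g top\<bar> < inverse (real (Suc n))" for n
  proof -
    let ?U = "{x. \<bar>g x - g top\<bar> < inverse (real (Suc n))}"
    have "open ?U"
      by (intro open_Collect_less continuous_intros assms)
    then obtain b where "b < top" "{b<..top} \<subseteq> ?U"
      using open_left[of ?U top] bot_less_top_omega1 by auto
    then show ?thesis
      by (auto simp: subset_iff)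
  qed
  then obtain s where s: "\<And>n. s n < top"
    "\<And>n x. s n < x \<Longrightarrow> \<bar>g x - g top\<bar> < inverse (real (Suc n))"
    by metis
  obtain b where b: "b < top" "\<And>n. s n < b"
    using countable_strict_bound_omega1[of "range s"] s(1) by auto
  have "g x = g top" if "b \<le> x" for x
  proof (rule ccontr)
    assume "g x \<noteq> g top"
    then obtain n where "inverse (real (Suc n)) < \<bar>g x - g top\<bar>"
      using reals_Archimedean[of "\<bar>g x - g top\<bar>"] by auto
    moreover have "s n < x"
      using b(2) that by (rule less_le_trans)
    ultimately show False
      using s(2) by fastforce
  qed
  then show thesis
    using that b(1) by blast
qed

text \<open>The limit \<open>a\<close> is the least strict bound of the iterates of
  \<open>f\<close>; as \<open>f (y n)\<close> is itself the next iterate, it also stays below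
  \<open>a\<close>.\<close>

lemma closure_point_omega1:
  fixes f :: "omega1_interval \<Rightarrow> omega1_interval"
  assumes "\<And>y. y < top \<Longrightarrow> y < f y \<and> f y < top"
  obtains y a where "a < top" "y \<longlonglongrightarrow> a" "\<And>n. y n < a" "\<And>n. f (y n) < a"
proof -
  obtain y0 :: omega1_interval where "y0 < top"
    using bot_less_top_omega1 by blast
  define y where "y n = (f ^^ n) y0" for n
  have Suc: "y (Suc n) = f (y n)" for n
    by (simp add: y_def)
  have y_top: "y n < top" for n
    by (induction n) (use \<open>y0 < top\<close> assms Suc in \<open>auto simp: y_def\<close>)
  have mono: "strict_mono y"
    using assms y_top Suc by (simp add: strict_mono_Suc_iff)
  define a where "a = (LEAST b. \<forall>n. y n < b)"
  obtain b where b: "b < top" "\<And>n. y n < b"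
    using countable_strict_bound_omega1[of "range y"] y_top by auto
  have ya: "y n < a" for n
    using LeastI[of "\<lambda>b. \<forall>n. y n < b" b] b(2) by (simp add: a_def)
  have "a \<le> b"
    unfolding a_def by (rule Least_le) (use b(2) in blast)
  then have "a < top"
    using b(1) by (rule le_less_trans)
  moreover have "y \<longlonglongrightarrow> a"
  proof (rule order_tendstoI)
    fix z assume "z < a"
    \<comment> \<open>By minimality of \<open>a\<close>, \<open>z\<close> is not a strict bound.
      This gives only \<open>z \<le> y m\<close>, so the strict inequality starts one index
      later.\<close>
    then obtain m where "z \<le> y m"
      using not_less_Least[of z "\<lambda>b. \<forall>n. y n < b"] by (auto simp: a_def not_less)
    then have "z < y n" if "n \<ge> Suc m" for n
      using strict_monoD[OF mono, of m n] that by auto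
    then show "\<forall>\<^sub>F n in sequentially. z < y n"
      using eventually_at_top_linorder by blast
  next
    fix z assume "a < z"
    then show "\<forall>\<^sub>F n in sequentially. y n < z"
      using ya by (intro always_eventually allI) (rule less_trans)
  qed
  moreover have "f (y n) < a" for n
    using ya[of "Suc n"] Suc by simp
  ultimately show thesis
    using that ya by blast
qed

theorem no_closeness_function_omega1:
  "\<not> closeness_function (c :: omega1_interval \<times> omega1_interval \<times> omega1_interval \<Rightarrow> real)"
proof
  assume "closeness_function c"
  then have cont: "continuous_on {(x, y, z). y \<noteq> z} c"
    and anti: "\<And>x y z. y \<noteq> z \<Longrightarrow> c (x, y, z) = - c (x, z, y)"
    and diag: "\<And>x z. x \<noteq> z \<Longrightarrow> c (x, x, z) = 1"
    unfolding closeness_function_def by blast+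
  have "\<exists>b. y < b \<and> b < top \<and> (\<forall>x\<ge>b. c (x, y, top) = -1)" if y: "y < top" for y
  proof -
    have "continuous_on UNIV (\<lambda>x. c (x, y, top))"
      using y by (intro continuous_on_compose2[OF cont] continuous_intros) auto
    then obtain b where b: "b < top" "\<And>x. b \<le> x \<Longrightarrow> c (x, y, top) = c (top, y, top)"
      using eventually_const_at_omega1 by blast
    have "c (top, y, top) = -1"
      using anti[of y top top] diag[of top y] y by simp
    then have "c (x, y, top) = -1" if "b \<le> x" for x
      using b(2)[OF that] by simp
    \<comment> \<open>The threshold is raised above \<open>y\<close> too, because
      \<open>closure_point_omega1\<close> needs \<open>y < f y\<close>.\<close>
    moreover obtain b' where "b' < top" "b < b'" "y < b'"
      using countable_strict_bound_omega1[of "{b, y}"] b(1) y by auto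
    ultimately show ?thesis
      by (intro exI[of _ b']) auto
  qed
  then obtain f where f: "\<And>y. y < top \<Longrightarrow> y < f y \<and> f y < top"
    "\<And>x y. y < top \<Longrightarrow> f y \<le> x \<Longrightarrow> c (x, y, top) = -1"
    by metis
  obtain y a where a: "a < top" "y \<longlonglongrightarrow> a" "\<And>n. y n < a" "\<And>n. f (y n) < a"
    using closure_point_omega1[of f] f(1) by metis
  have y_top: "y n < top" for n
    using a(1,3) by (rule less_trans[rotated])
  have "(\<lambda>n. c (a, y n, top)) \<longlonglongrightarrow> c (a, a, top)"
  proof (rule continuous_on_tendsto_compose[OF cont])
    show "(\<lambda>n. (a, y n, top)) \<longlonglongrightarrow> (a, a, top)"
      by (intro tendsto_intros a(2))
    show "(a, a, top) \<in> {(x, y, z). y \<noteq> z}"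
      using a(1) by auto
    show "\<forall>\<^sub>F n in sequentially. (a, y n, top) \<in> {(x, y, z). y \<noteq> z}"
      using y_top by (auto simp: less_le)
  qed
  \<comment> \<open>The one point \<open>a\<close> lies beyond the thresholds of all
    \<open>y n\<close> simultaneously.\<close>
  moreover have "c (a, y n, top) = -1" for n
    using f(2)[OF y_top] a(4)[of n] by simp
  ultimately have "c (a, a, top) = -1"
    by (simp add: LIMSEQ_const_iff)
  then show False
    using diag[of a top] a(1) by auto
qed

section \<open>Finitely supported signed measures\<close>

text \<open>For finite \<open>F\<close>, the combination of Dirac measures at the points of
  \<open>F\<close> with weights \<open>w\<close>. The value 0 off the Borel sets follows the
  convention for signed measures.\<close>

definition point_masses :: "'a::t2_space set \<Rightarrow> ('a \<Rightarrow> real) \<Rightarrow> 'a set \<Rightarrow> real" where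
  "point_masses F w A = (if A \<in> sets borel then \<Sum>p\<in>A \<inter> F. w p else 0)"

context
  fixes F :: "'a::t2_space set"
  assumes F: "finite F"
begin

lemma finite_borel: "B \<subseteq> F \<Longrightarrow> B \<in> sets borel"
  using F by (simp add: borel_closed finite_imp_closed finite_subset)

lemma signed_borel_measure_point_masses: "signed_borel_measure (point_masses F w)"
  unfolding signed_borel_measure_def
proof (intro conjI allI impI)
  fix A :: "nat \<Rightarrow> 'a set"
  assume A: "range A \<subseteq> sets borel \<and> disjoint_family A"
  have eq: "point_masses F w B = (\<Sum>p\<in>F. if p \<in> B then w p else 0)" if "B \<in> sets borel" for B
    using that sum.inter_restrict[OF F, of w B] by (simp add: point_masses_def Int_commute[of F B])
  \<comment> \<open>By disjointness \<open>p\<close> lies in at most one \<open>A n\<close>, so the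
    series has at most one nonzero term.\<close>
  have "(\<lambda>n. if p \<in> A n then w p else 0) sums (if p \<in> (\<Union>n. A n) then w p else 0)" for p
  proof (cases "p \<in> (\<Union>n. A n)")
    case True
    then obtain k where k: "p \<in> A k"
      by blast
    then have "p \<in> A n \<longleftrightarrow> n = k" for n
      using A by (auto simp: disjoint_family_on_def)
    then show ?thesis
      using True sums_single[of k "\<lambda>_. w p"] by simp
  qed simp
  then have "(\<lambda>n. \<Sum>p\<in>F. if p \<in> A n then w p else 0) sums
      (\<Sum>p\<in>F. if p \<in> (\<Union>n. A n) then w p else 0)"
    by (intro sums_sum)
  moreover have "A n \<in> sets borel" for n
    using A by auto
  ultimately show "(\<lambda>n. point_masses F w (A n)) sums point_masses F w (\<Union>n. A n)"
    by (simp add: eq)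
qed (simp add: point_masses_def)

lemma pos_part_point_masses:
  "pos_part (point_masses F w) = point_masses F (\<lambda>p. max 0 (w p))"
proof
  fix A :: "'a set"
  show "pos_part (point_masses F w) A = point_masses F (\<lambda>p. max 0 (w p)) A"
  proof (cases "A \<in> sets borel")
    case A: True
    have "(SUP B\<in>{B \<in> sets borel. B \<subseteq> A}. point_masses F w B) = (\<Sum>p\<in>A \<inter> F. max 0 (w p))"
    proof (rule cSup_eq_maximum)
      \<comment> \<open>The supremum is attained at the set of points of positive weight, which is
        Borel because it is finite.\<close>
      let ?B = "{p \<in> A \<inter> F. w p > 0}"
      have "(\<Sum>p\<in>A \<inter> F. max 0 (w p)) = (\<Sum>p\<in>?B. w p)"
        using F by (intro sum.mono_neutral_cong_right) (auto simp: max_def)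
      also have "\<dots> = point_masses F w ?B"
        using finite_borel[of ?B] by (auto simp: point_masses_def intro!: sum.cong)
      finally show "(\<Sum>p\<in>A \<inter> F. max 0 (w p)) \<in>
          point_masses F w ` {B \<in> sets borel. B \<subseteq> A}"
        using finite_borel[of ?B] by blast
    next
      fix v assume "v \<in> point_masses F w ` {B \<in> sets borel. B \<subseteq> A}"
      then obtain B where B: "B \<in> sets borel" "B \<subseteq> A" "v = (\<Sum>p\<in>B \<inter> F. w p)"
        by (auto simp: point_masses_def)
      have "v \<le> (\<Sum>p\<in>B \<inter> F. max 0 (w p))"
        unfolding B(3) by (intro sum_mono) simp
      also have "\<dots> \<le> (\<Sum>p\<in>A \<inter> F. max 0 (w p))"
        using F B(2) by (intro sum_mono2) auto
      finally show "v \<le> (\<Sum>p\<in>A \<inter> F. max 0 (w p))" .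
    qed
    then show ?thesis
      using A by (simp add: pos_part_def point_masses_def)
  qed (simp add: pos_part_def point_masses_def)
qed

lemma neg_part_point_masses:
  "neg_part (point_masses F w) = point_masses F (\<lambda>p. max 0 (- w p))"
proof -
  have "(\<lambda>A. - point_masses F w A) = point_masses F (\<lambda>p. - w p)"
    by (auto simp: point_masses_def sum_negf)
  then show ?thesis
    by (simp add: neg_part_def pos_part_point_masses)
qed

lemma variation_point_masses:
  "variation (point_masses F w) = point_masses F (\<lambda>p. \<bar>w p\<bar>)"
  by (rule ext) (auto simp: variation_def pos_part_point_masses neg_part_point_masses
      point_masses_def simp flip: sum.distrib intro!: sum.cong)

text \<open>The compact set \<open>A \<inter> F\<close> and the open complement of
  \<open>F - A\<close> differ by a set that misses \<open>F\<close>, hence has variation 0.\<close>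

lemma regular_point_masses: "point_masses F w \<in> regular_signed_measures"
proof -
  have "\<exists>C U. compact C \<and> open U \<and> C \<subseteq> A \<and> A \<subseteq> U \<and>
      variation (point_masses F w) (U - C) < \<epsilon>" if "\<epsilon> > 0" for A \<epsilon>
  proof (intro exI conjI)
    show "compact (A \<inter> F)"
      using F by (simp add: finite_imp_compact)
    show "open (- (F - A))"
      using F by (intro open_Compl finite_imp_closed) auto
    have "(- (F - A) - A \<inter> F) \<inter> F = {}"
      by auto
    then show "variation (point_masses F w) (- (F - A) - A \<inter> F) < \<epsilon>"
      using that by (simp add: variation_point_masses point_masses_def)
  qed auto
  then show ?thesis
    by (simp add: regular_signed_measures_def signed_borel_measure_point_masses)
qed

lemma integral_point_masses_nonneg:
  fixes f :: "'a \<Rightarrow> real"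
  assumes w: "\<And>p. w p \<ge> 0" and f: "f \<in> borel_measurable borel"
  shows "(LINT x|as_measure (point_masses F w). f x) = (\<Sum>p\<in>F. w p * f p)"
proof -
  let ?M = "point_measure F (\<lambda>p. ennreal (w p))"
  have id: "(\<lambda>x. x) \<in> measurable ?M borel"
    by (simp add: measurable_def space_point_measure sets_point_measure)
  \<comment> \<open>\<open>as_measure\<close> is identified with the image of the point measure on
    \<open>F\<close> under the inclusion, which reduces the integral to a finite sum.\<close>
  let ?N = "distr ?M borel (\<lambda>x. x)"
  have N: "emeasure ?N A = ennreal (point_masses F w A)" if "A \<in> sets borel" for A
    using that F id w
    by (simp add: emeasure_distr space_point_measure emeasure_point_measure_finite
        point_masses_def sum_ennreal)
  have sigma: "sigma_sets UNIV (sets (borel :: 'a measure)) = sets borel"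
    using sets.sigma_sets_eq[of "borel :: 'a measure"] by simp
  have "as_measure (point_masses F w) = measure_of UNIV (sets borel) (emeasure ?N)"
    unfolding as_measure_def by (rule measure_of_eq) (simp_all add: sigma N del: emeasure_distr)
  also have "\<dots> = measure_of (space ?N) (sets ?N) (emeasure ?N)"
    by simp
  finally have "as_measure (point_masses F w) =
      measure_of (space ?N) (sets ?N) (emeasure ?N)" .
  then have "as_measure (point_masses F w) = ?N"
    by (simp only: measure_of_of_measure)
  then show ?thesis
    using F w id f by (simp add: integral_distr lebesgue_integral_point_measure_finite)
qed

lemma signed_integral_point_masses:
  assumes "continuous_on UNIV f"
  shows "signed_integral (point_masses F w) f = (\<Sum>p\<in>F. w p * f p)"
proof -
  have "f \<in> borel_measurable borel"
    using assms by (rule borel_measurable_continuous_onI)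
  then have "signed_integral (point_masses F w) f =
      (\<Sum>p\<in>F. max 0 (w p) * f p) - (\<Sum>p\<in>F. max 0 (- w p) * f p)"
    by (simp add: signed_integral_def pos_part_point_masses neg_part_point_masses
        integral_point_masses_nonneg)
  also have "\<dots> = (\<Sum>p\<in>F. w p * f p)"
    unfolding sum_subtractf[symmetric] by (intro sum.cong) (auto simp: max_def algebra_simps)
  finally show ?thesis .
qed

text \<open>Domination forces \<open>\<nu>\<close> to vanish on \<open>A - F\<close>; finite
  additivity then leaves only the singletons of \<open>A \<inter> F\<close>.\<close>

lemma dominated_by_point_masses:
  assumes \<nu>: "signed_borel_measure \<nu>"
    and le: "\<And>A. A \<in> sets borel \<Longrightarrow> 0 \<le> \<nu> A \<and> \<nu> A \<le> point_masses F w A"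
  shows "\<nu> = point_masses F (\<lambda>p. \<nu> {p})"
proof
  fix A :: "'a set"
  have add: "\<nu> (B \<union> C) = \<nu> B + \<nu> C"
    if "B \<in> sets borel" "C \<in> sets borel" "B \<inter> C = {}" for B C
  proof -
    have empty: "\<nu> {} = 0"
      using le[of "{}"] by (simp add: point_masses_def)
    \<comment> \<open>Finite additivity comes from the disjoint sequence \<open>B\<close>,
      \<open>C\<close>, \<open>{}\<close>, \<open>{}\<close>, ..., using that \<open>\<nu>\<close>
      vanishes at \<open>{}\<close>.\<close>
    have "range (binaryset B C) \<subseteq> sets borel \<and> disjoint_family (binaryset B C)"
      using that by (auto simp: range_binaryset_eq disjoint_family_on_def binaryset_def)
    then have "(\<lambda>n. \<nu> (binaryset B C n)) sums \<nu> (B \<union> C)"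
      using \<nu> unfolding signed_borel_measure_def UN_binaryset_eq[symmetric] by blast
    moreover have "(\<lambda>n. \<nu> (binaryset B C n)) sums (\<nu> B + \<nu> C)"
      using binaryset_sums[of \<nu> B C] empty by simp
    ultimately show ?thesis
      by (rule sums_unique2)
  qed
  have fin: "\<nu> B = (\<Sum>p\<in>B. \<nu> {p})" if "B \<subseteq> F" for B
  proof -
    have "finite B"
      using that F by (rule finite_subset)
    then show ?thesis
      using that
    proof (induction B rule: finite_induct)
      case empty
      show ?case
        using le[of "{}"] by (simp add: point_masses_def)
    next
      case (insert p B)
      then show ?case
        using add[of "{p}" B] finite_borel[of B] finite_borel[of "{p}"] by simp
    qed
  qed
  show "\<nu> A = point_masses F (\<lambda>p. \<nu> {p}) A"
  proof (cases "A \<in> sets borel")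
    case A: True
    then have "A - F \<in> sets borel"
      using finite_borel[of F] by blast
    moreover have "(A - F) \<inter> F = {}"
      by auto
    ultimately have "\<nu> (A - F) = 0"
      using le[of "A - F"] by (simp add: point_masses_def)
    moreover have "(A \<inter> F) \<union> (A - F) = A"
      by auto
    ultimately have "\<nu> A = \<nu> (A \<inter> F)"
      using add[of "A \<inter> F" "A - F"] finite_borel[of "A \<inter> F"] \<open>A - F \<in> sets borel\<close> by auto
    then show ?thesis
      using A fin[of "A \<inter> F"] by (simp add: point_masses_def)
  next
    case False
    then show ?thesis
      using \<nu> by (simp add: signed_borel_measure_def point_masses_def)
  qed
qed

end

section \<open>The weak* topology\<close>

lemma continuous_map_signed_integral:
  assumes "continuous_on UNIV f"
  shows "continuous_map weak_star euclidean (\<lambda>\<mu>. signed_integral \<mu> f)"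
  unfolding continuous_map_def topspace_weak_star
  using assms
  by (auto simp: weak_star_def intro!: topology_generated_by_Basis)

text \<open>Universal property of an initial topology: only preimages of subbasic sets need to be
  checked.\<close>

lemma continuous_map_into_weak_star:
  assumes "\<And>x. x \<in> topspace X \<Longrightarrow> g x \<in> regular_signed_measures"
    and "\<And>f. continuous_on UNIV f \<Longrightarrow> continuous_map X euclidean (\<lambda>x. signed_integral (g x) f)"
  shows "continuous_map X weak_star g"
  unfolding weak_star_def
proof (rule continuous_on_generated_topo)
  fix W :: "('b set \<Rightarrow> real) set"
  assume "W \<in> {{\<mu> \<in> regular_signed_measures. signed_integral \<mu> f \<in> V} | f V.
    continuous_on UNIV f \<and> open V}"
  then obtain f V where W: "W = {\<mu> \<in> regular_signed_measures. signed_integral \<mu> f \<in> V}"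
    "continuous_on UNIV f" "open V"
    by blast
  have "g -` W \<inter> topspace X = {x \<in> topspace X. signed_integral (g x) f \<in> V}"
    using assms(1) W(1) by auto
  then show "openin X (g -` W \<inter> topspace X)"
    using openin_continuous_map_preimage[OF assms(2)[OF W(2)], of V] W(3) by simp
next
  show "g ` topspace X \<subseteq> \<Union> {{\<mu> \<in> regular_signed_measures. signed_integral \<mu> f \<in> V} | f V.
      continuous_on UNIV f \<and> open V}"
    using assms(1) topspace_weak_star[where 'a='b]
    unfolding weak_star_def topology_generated_by_topspace by auto
qed

section \<open>From compensation functions to closeness functions\<close>

text \<open>Adding indicators keeps the formula correct when points coincide; for instance,
  \<open>x = y\<close> leaves mass 1/3 at \<open>z\<close> alone.\<close>

definition dirac_combination :: "'a::t2_space \<times> 'a \<times> 'a \<Rightarrow> 'a set \<Rightarrow> real" where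
  "dirac_combination = (\<lambda>(x, y, z). point_masses {x, y, z}
     (\<lambda>p. (of_bool (p = y) + of_bool (p = z) - of_bool (p = x)) / 3))"

lemma dirac_combination_commute: "dirac_combination (x, y, z) = dirac_combination (x, z, y)"
  by (auto simp: dirac_combination_def insert_commute add.commute)

lemma sum_dirac_combination:
  "(\<Sum>p\<in>{x, y, z}. (of_bool (p = y) + of_bool (p = z) - of_bool (p = x)) / 3 * f p) =
     (f y + f z - f x) / (3 :: real)"
proof -
  \<comment> \<open>Isolating the term at \<open>q\<close> avoids a case distinction on coincidences
    among the three points.\<close>
  have *: "(\<Sum>p\<in>{x, y, z}. of_bool (p = q) * f p) = f q" if "q \<in> {x, y, z}" for q
    using that by (subst sum.remove[of _ q]) (auto intro!: sum.neutral)
  have "(\<Sum>p\<in>{x, y, z}. (of_bool (p = y) + of_bool (p = z) - of_bool (p = x)) / 3 * f p) =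
      ((\<Sum>p\<in>{x, y, z}. of_bool (p = y) * f p) + (\<Sum>p\<in>{x, y, z}. of_bool (p = z) * f p) -
        (\<Sum>p\<in>{x, y, z}. of_bool (p = x) * f p)) / 3"
    unfolding sum.distrib[symmetric] sum_subtractf[symmetric] sum_divide_distrib
    by (intro sum.cong) (auto simp: field_simps)
  then show ?thesis
    by (simp only: *[of x] *[of y] *[of z] insert_iff simp_thms)
qed

lemma signed_integral_dirac_combination:
  assumes "continuous_on UNIV f"
  shows "signed_integral (dirac_combination (x, y, z)) f = (f y + f z - f x) / 3"
  by (simp only: dirac_combination_def prod.case signed_integral_point_masses[OF _ assms]
      finite.intros sum_dirac_combination)

lemma dirac_combination_UNIV: "dirac_combination (x, y, z) UNIV = 1 / 3"
  using sum_dirac_combination[of y z x "\<lambda>_. 1"]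
  by (simp add: dirac_combination_def point_masses_def)

lemma dirac_combination_in_ball: "dirac_combination t \<in> signed_measure_ball"
proof -
  obtain x y z where t: "t = (x, y, z)"
    by (cases t) auto
  let ?w = "\<lambda>p. (of_bool (p = y) + of_bool (p = z) - of_bool (p = x)) / 3 :: real"
  \<comment> \<open>Distinct points give three weights of modulus 1/3; merging weights at coinciding
    points cannot increase the sum.\<close>
  have "(\<Sum>p\<in>{x, y, z}. \<bar>?w p\<bar>) \<le> 1"
    by (cases "x = y"; cases "x = z"; cases "y = z") (auto simp: insert_commute)
  then show ?thesis
    by (simp add: t signed_measure_ball_def dirac_combination_def regular_point_masses
        variation_point_masses point_masses_def del: sum.insert)
qed

lemma continuous_dirac_combination:
  "continuous_map euclidean (subtopology weak_star signed_measure_ball) dirac_combination"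
proof (rule continuous_map_into_subtopology)
  show "dirac_combination \<in> topspace euclidean \<rightarrow> signed_measure_ball"
    using dirac_combination_in_ball by auto
  show "continuous_map euclidean weak_star
      (dirac_combination :: 'a \<times> 'a \<times> 'a \<Rightarrow> 'a set \<Rightarrow> real)"
  proof (rule continuous_map_into_weak_star)
    fix f :: "'a \<Rightarrow> real" assume f: "continuous_on UNIV f"
    have "(\<lambda>t. signed_integral (dirac_combination t) f) =
        (\<lambda>t. (f (fst (snd t)) + f (snd (snd t)) - f (fst t)) / 3)"
      using signed_integral_dirac_combination[OF f] by auto
    then show "continuous_map euclidean euclidean (\<lambda>t. signed_integral (dirac_combination t) f)"
      by (auto intro!: continuous_intros continuous_on_compose2[OF f])
  qed (use dirac_combination_in_ball in \<open>auto simp: signed_measure_ball_def\<close>)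
qed

lemma compensation_dirac_combination:
  assumes comp: "compensation \<nu> (dirac_combination (x, y, z))" and "y \<noteq> z"
  shows "\<And>p. \<nu> {p} \<ge> 0" and "\<nu> {y} + \<nu> {z} = 1 / 3"
    and "x \<in> {y, z} \<Longrightarrow> \<nu> {x} = 0"
    and "continuous_on UNIV f \<Longrightarrow> signed_integral \<nu> f = \<nu> {y} * f y + \<nu> {z} * f z"
proof -
  let ?w = "\<lambda>p. (of_bool (p = y) + of_bool (p = z) - of_bool (p = x)) / 3 :: real"
  have "pos_part (dirac_combination (x, y, z)) = point_masses {x, y, z} (\<lambda>p. max 0 (?w p))"
    by (simp add: dirac_combination_def pos_part_point_masses)
  then have \<nu>: "signed_borel_measure \<nu>" and UNIV: "\<nu> UNIV = 1 / 3"
    and le: "\<And>A. A \<in> sets borel \<Longrightarrow>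
      0 \<le> \<nu> A \<and> \<nu> A \<le> point_masses {x, y, z} (\<lambda>p. max 0 (?w p)) A"
    using comp
    by (simp_all add: compensation_def dirac_combination_UNIV regular_signed_measures_def)
  show nonneg: "\<nu> {p} \<ge> 0" for p
    using le[of "{p}"] by (simp add: borel_closed)
  have "\<nu> {x} \<le> max 0 (?w x)"
    using le[of "{x}"] by (simp add: borel_closed point_masses_def)
  \<comment> \<open>Since \<open>y \<noteq> z\<close>, at most one of them equals \<open>x\<close>,
    and the negative mass at \<open>x\<close> cancels its contribution.\<close>
  also have "\<dots> = 0"
    using \<open>y \<noteq> z\<close> by auto
  finally have x: "\<nu> {x} = 0"
    using nonneg[of x] by simp
  then show "x \<in> {y, z} \<Longrightarrow> \<nu> {x} = 0"
    by simp
  have rep: "\<nu> = point_masses {x, y, z} (\<lambda>p. \<nu> {p})"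
    using dominated_by_point_masses[OF _ \<nu> le] by simp
  \<comment> \<open>Either \<open>x\<close> repeats \<open>y\<close> or \<open>z\<close> in the
    index set, or its term vanishes.\<close>
  have sum: "(\<Sum>p\<in>{x, y, z}. \<nu> {p} * g p) = \<nu> {y} * g y + \<nu> {z} * g z" for g
    using x \<open>y \<noteq> z\<close> by (cases "x \<in> {y, z}") (auto simp: insert_absorb)
  show "\<nu> {y} + \<nu> {z} = 1 / 3"
    using UNIV sum[of "\<lambda>_. 1"] by (subst (asm) rep) (simp add: point_masses_def)
  show "signed_integral \<nu> f = \<nu> {y} * f y + \<nu> {z} * f z" if "continuous_on UNIV f"
    by (subst rep) (simp only: signed_integral_point_masses[OF _ that] finite.intros sum)
qed

text \<open>Compact Hausdorff spaces are normal, so Urysohn's lemma applies to the closed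
  singletons.\<close>

lemma compact_t2_Urysohn_real:
  fixes y z :: "'a::t2_space"
  assumes "compact (UNIV :: 'a set)" and "y \<noteq> z"
  obtains g :: "'a \<Rightarrow> real" where "continuous_on UNIV g" "g y = a" "g z = b"
proof -
  have "Hausdorff_space (euclidean :: 'a topology)"
    by (simp add: Hausdorff_space_def disjnt_def) (metis hausdorff)
  moreover have "compact_space (euclidean :: 'a topology)"
    using assms(1) by (simp add: compact_space_def)
  ultimately have "normal_space (euclidean :: 'a topology)"
    by (simp add: compact_Hausdorff_or_regular_imp_normal_space)
  then show thesis
    using Urysohn_lemma_alt[of euclidean "{y}" "{z}" a b] assms(2) that
    by (auto simp: disjnt_def)
qed

theorem compensation_imp_closeness:
  fixes \<xi> :: "('a::t2_space set \<Rightarrow> real) \<Rightarrow> 'a set \<Rightarrow> real"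
  assumes "compact (UNIV :: 'a set)" and "ball_compensation_function \<xi>"
  obtains c :: "'a \<times> 'a \<times> 'a \<Rightarrow> real" where "closeness_function c"
proof -
  define \<nu> where "\<nu> t = \<xi> (dirac_combination t)" for t
  define c where "c = (\<lambda>(x, y, z). 3 * (\<nu> (x, y, z) {z} - \<nu> (x, y, z) {y}))"
  have \<xi>: "continuous_map (subtopology weak_star signed_measure_ball) weak_star \<xi>"
    and comp: "\<And>t. compensation (\<nu> t) (dirac_combination t)"
    using assms(2) dirac_combination_in_ball by (auto simp: ball_compensation_function_def \<nu>_def)
  note \<nu> = compensation_dirac_combination[OF comp]
  have cont: "continuous_on UNIV (\<lambda>t. signed_integral (\<nu> t) f)" if f: "continuous_on UNIV f" for f
    using continuous_map_compose[OF continuous_map_compose[OF continuous_dirac_combination \<xi>]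
        continuous_map_signed_integral[OF f]]
    by (simp add: o_def \<nu>_def)
  have isCont: "isCont c (x, y, z)" if yz: "y \<noteq> z" for x y z
  proof -
    \<comment> \<open>The values -2 and 2 lie strictly beyond the truncation levels -1 and 1, so the
      open conditions defining \<open>?W\<close> below hold at the given triple.\<close>
    obtain g :: "'a \<Rightarrow> real" where g: "continuous_on UNIV g" "g y = -2" "g z = 2"
      using compact_t2_Urysohn_real[OF assms(1) yz] by blast
    \<comment> \<open>Truncation makes the test function constant in neighbourhoods of \<open>y\<close> and \<open>z\<close>.\<close>
    define f where "f p = max (-1) (min 1 (g p))" for p
    have f: "continuous_on UNIV f"
      unfolding f_def by (intro continuous_intros g(1))
    let ?W = "UNIV \<times> {p. g p < -1} \<times> {p. 1 < g p}"
    have "open ?W"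
      by (intro open_Times open_Collect_less continuous_intros g(1)) auto
    moreover have "(x, y, z) \<in> ?W"
      using g by simp
    moreover have "c t = 3 * signed_integral (\<nu> t) f" if t: "t \<in> ?W" for t
    proof -
      obtain x' y' z' where t': "t = (x', y', z')"
        by (cases t) auto
      have "g y' < -1" "1 < g z'"
        using t t' by auto
      then have "f y' = -1" "f z' = 1" "y' \<noteq> z'"
        by (auto simp: f_def)
      then show ?thesis
        using \<nu>(4)[of y' z' f x'] f by (simp add: t' c_def)
    qed
    ultimately have "\<forall>\<^sub>F t in nhds (x, y, z). c t = 3 * signed_integral (\<nu> t) f"
      unfolding eventually_nhds by blast
    moreover have "isCont (\<lambda>t. 3 * signed_integral (\<nu> t) f) (x, y, z)"
      using cont[OF f] by (intro continuous_intros) (simp add: continuous_on_eq_continuous_at)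
    ultimately show ?thesis
      using isCont_cong[of c "\<lambda>t. 3 * signed_integral (\<nu> t) f" "(x, y, z)"] by simp
  qed
  have "closeness_function c"
    unfolding closeness_function_def
  proof (intro conjI allI impI)
    show "continuous_on {(x, y, z). y \<noteq> z} c"
      using isCont by (auto intro!: continuous_at_imp_continuous_on)
  next
    fix x y z :: 'a
    assume "y \<noteq> z"
    \<comment> \<open>Two nonnegative masses with sum 1/3 differ by at most 1/3.\<close>
    then show "c (x, y, z) \<in> {-1..1}"
      using \<nu>(1)[of y z x y] \<nu>(1)[of y z x z] \<nu>(2)[of y z x] by (auto simp: c_def)
    \<comment> \<open>Both triples give the same measure; only the order of the two masses
      changes.\<close>
    show "c (x, y, z) = - c (x, z, y)"
      by (simp add: c_def \<nu>_def dirac_combination_commute[of x z y])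
  next
    fix x z :: 'a
    assume "x \<noteq> z"
    \<comment> \<open>The compensation has no mass at \<open>x\<close>, so the full 1/3 sits at
      \<open>z\<close>.\<close>
    then show "c (x, x, z) = 1"
      using \<nu>(2)[of x z x] \<nu>(3)[of x z x] by (simp add: c_def)
  qed
  then show thesis
    by (rule that)
qed

theorem corollary4p10:
  shows "(\<nexists>c :: omega1_interval \<times> omega1_interval \<times> omega1_interval \<Rightarrow> real. closeness_function c) \<and>
    (\<nexists>\<xi> :: (omega1_interval set \<Rightarrow> real) \<Rightarrow> omega1_interval set \<Rightarrow> real. ball_compensation_function \<xi>)"
  using no_closeness_function_omega1 compensation_imp_closeness[OF compact_omega1_interval]
  by metis

end
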